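(* Let $\mathbf{C}$ be the Cantor set, let $X \subset \mathbf{C}$, and let $f : X \to Y$ be a function from $X$ onto a separable metrizable space $Y$. Assume that $f$ is clopen-LC, and that $f^{-1}(y)$ is compact for every $y \in Y$. Then there are subsets $Y_0, Y_1, Y_2, \dots$ of $Y$ with $Y = \bigcup_{n \ge 0} Y_n$ such that: - for every $n \ge 1$, the restriction $f|_{f^{-1}(Y_n)} : f^{-1}(Y_n) \to Y_n$ is an open function; - the restriction $f|_{f^{-1}(Y_0)} : f^{-1}(Y_0) \to Y_0$ is a closed function.
   Context: All spaces are separable metrizable. A subset of a topological space is an LC-set (locally closed set) if it is the intersection of an open set and a closed set. A function $f$ (not necessarily continuous) is open (resp. closed) if it maps open (resp. closed) sets to open (resp. closed) sets of its image space. A function $f : X \to Y$ is clopen-LC if for every subset $U \subset X$ that is clopen in $X$, the image $f(U)$ is an LC-set in $Y$. *)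

theory Defs
  imports "HOL-Analysis.Analysis"
begin

definition cantor_set :: "real set" where
  "cantor_set = {x. \<exists>d::nat \<Rightarrow> nat. (\<forall>n. d n \<in> {0, 2}) \<and>
                    x = (\<Sum>n. real (d n) / 3 ^ Suc n)}"

definition lc_set :: "'a topology \<Rightarrow> 'a set \<Rightarrow> bool" where
  "lc_set T S \<longleftrightarrow> (\<exists>U C. openin T U \<and> closedin T C \<and> S = U \<inter> C)"

definition clopen_LC :: "'a topology \<Rightarrow> 'b topology \<Rightarrow> ('a \<Rightarrow> 'b) \<Rightarrow> bool" where
  "clopen_LC X Y f \<longleftrightarrow> (\<forall>U. openin X U \<and> closedin X U \<longrightarrow> lc_set Y (f ` U))"

end

theory Submission
  imports Defs
begin

text \<open>For clopen \<open>U\<close> in \<open>X\<close> put \<open>Z U = closure (f U) - f U\<close>, which is closed because \<open>f U\<close> is locally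
  closed. Over \<open>Z U\<close> the function \<open>f\<close> is open: if \<open>V\<close> is clopen and \<open>y \<in> f V\<close> lies in \<open>Z U\<close>, then \<open>y\<close>
  is not in the closed set \<open>Z (U \<union> V)\<close>, and every point of \<open>Z U\<close> outside \<open>Z (U \<union> V)\<close> lies in \<open>f V\<close>.
  Let \<open>U\<close> range over the complements of finite unions of sets from a countable clopen base and let
  \<open>Y\<^sub>0\<close> consist of the points outside all these \<open>Z U\<close>. Compactness of the fibres makes \<open>f\<close> closed
  over \<open>Y\<^sub>0\<close>.\<close>

section \<open>Decomposition over a countable clopen base\<close>

text \<open>With \<open>S = U \<inter> C\<close>, the closure of \<open>S\<close> stays inside
  \<open>C\<close>, so removing \<open>S\<close> from it amounts to removing the open set
  \<open>U\<close>.\<close>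

lemma lc_set_closedin_frontier:
  assumes "lc_set Y S"
  shows "closedin Y (Y closure_of S - S)"
proof -
  obtain U C where UC: "openin Y U" "closedin Y C" "S = U \<inter> C"
    using assms by (auto simp: lc_set_def)
  have "Y closure_of S \<subseteq> C"
    using UC by (intro closure_of_minimal) auto
  hence "Y closure_of S - S = Y closure_of S - U"
    using UC by auto
  thus ?thesis
    using UC by (simp add: closedin_diff)
qed

lemma open_map_over_frontier:
  assumes fXY: "f ` topspace X \<subseteq> topspace Y"
    and LC: "clopen_LC X Y f"
    and clopen: "\<And>B. B \<in> \<B> \<Longrightarrow> openin X B \<and> closedin X B"
    and base: "\<And>W x. openin X W \<Longrightarrow> x \<in> W \<Longrightarrow> \<exists>B\<in>\<B>. x \<in> B \<and> B \<subseteq> W"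
    and U: "openin X U" "closedin X U"
    and S: "S = Y closure_of (f ` U) - f ` U"
  shows "open_map (subtopology X {x \<in> topspace X. f x \<in> S}) (subtopology Y S) f"
  unfolding open_map_def
proof (intro allI impI)
  fix W' assume "openin (subtopology X {x \<in> topspace X. f x \<in> S}) W'"
  then obtain W where W: "openin X W" "W' = W \<inter> {x \<in> topspace X. f x \<in> S}"
    by (auto simp: openin_subtopology)
  show "openin (subtopology Y S) (f ` W')"
  proof (subst openin_subopen, intro ballI)
    fix y assume "y \<in> f ` W'"
    then obtain x where x: "x \<in> W" "f x \<in> S" "y = f x" "x \<in> topspace X"
      using W by auto
    obtain V where V: "V \<in> \<B>" "x \<in> V" "V \<subseteq> W"
      using base W x by blast
    define Z where "Z = Y closure_of (f ` (U \<union> V)) - f ` (U \<union> V)"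
    have "lc_set Y (f ` (U \<union> V))"
      using LC U clopen[OF V(1)] unfolding clopen_LC_def by blast
    hence "openin Y (topspace Y - Z)"
      unfolding Z_def by (intro openin_diff lc_set_closedin_frontier) auto
    hence "openin (subtopology Y S) ((topspace Y - Z) \<inter> S)"
      by (auto simp: openin_subtopology)
    moreover have "y \<in> (topspace Y - Z) \<inter> S"
      using x V fXY by (auto simp: Z_def)
    moreover have "(topspace Y - Z) \<inter> S \<subseteq> f ` W'"
    proof
      fix z assume z: "z \<in> (topspace Y - Z) \<inter> S"
      \<comment> \<open>As \<open>z\<close> lies in \<open>S\<close>, it is in the closure of
        \<open>f\<close> U\<open>, hence in that of\<close>f \<open>(U \<union> V)\<close>. Being
        outside \<open>Z\<close>, it lies in \<open>f\<close> (U \<union>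
        V)\<open>, and\<close>S\<open>misses\<close>f \<open>U\<close>, so \<open>V\<close> supplies
        a preimage.\<close>
      have "Y closure_of (f ` U) \<subseteq> Y closure_of (f ` (U \<union> V))"
        by (intro closure_of_mono) auto
      hence "z \<in> f ` V"
        using z by (auto simp: S Z_def)
      thus "z \<in> f ` W'"
        using z V W openin_subset[OF W(1)] by blast
    qed
    ultimately show "\<exists>T. openin (subtopology Y S) T \<and> y \<in> T \<and> T \<subseteq> f ` W'"
      by blast
  qed
qed

text \<open>If the fibre of \<open>y\<close> misses a closed set, finitely many base sets avoiding
  that set cover the fibre. The image of the complement of their union misses \<open>y\<close>, and
  by \<open>off\<close> so does its closure, which leaves a neighbourhood of
  \<open>y\<close>.\<close>

lemma closed_map_off_frontiers:
  assumes fXY: "f ` topspace X \<subseteq> topspace Y"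
    and opn: "\<And>B. B \<in> \<B> \<Longrightarrow> openin X B"
    and base: "\<And>W x. openin X W \<Longrightarrow> x \<in> W \<Longrightarrow> \<exists>B\<in>\<B>. x \<in> B \<and> B \<subseteq> W"
    and fibre: "\<And>y. y \<in> topspace Y \<Longrightarrow> compactin X {x \<in> topspace X. f x = y}"
    and S: "S \<subseteq> topspace Y"
    and off: "\<And>\<F>. finite \<F> \<Longrightarrow> \<F> \<subseteq> \<B> \<Longrightarrow>
      S \<inter> Y closure_of (f ` (topspace X - \<Union>\<F>)) \<subseteq> f ` (topspace X - \<Union>\<F>)"
  shows "closed_map (subtopology X {x \<in> topspace X. f x \<in> S}) (subtopology Y S) f"
  unfolding closed_map_def
proof (intro allI impI)
  fix C' assume "closedin (subtopology X {x \<in> topspace X. f x \<in> S}) C'"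
  then obtain C where C: "closedin X C" "C' = C \<inter> {x \<in> topspace X. f x \<in> S}"
    by (auto simp: closedin_subtopology)
  have "openin (subtopology Y S) (S - f ` C')"
  proof (subst openin_subopen, intro ballI)
    fix y assume y: "y \<in> S - f ` C'"
    let ?K = "{x \<in> topspace X. f x = y}"
    let ?\<G> = "{B \<in> \<B>. B \<inter> C = {}}"
    have "?K \<subseteq> \<Union>?\<G>"
    proof
      fix x assume x: "x \<in> ?K"
      hence "x \<in> topspace X - C"
        using y C by auto
      then obtain B where "B \<in> \<B>" "x \<in> B" "B \<subseteq> topspace X - C"
        using base[of "topspace X - C" x] C by blast
      thus "x \<in> \<Union>?\<G>"
        by blast
    qed
    moreover have "compactin X ?K"
      using fibre y S by blast
    moreover have "\<forall>B\<in>?\<G>. openin X B"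
      using opn by blast
    ultimately obtain \<F> where \<F>: "finite \<F>" "\<F> \<subseteq> ?\<G>" "?K \<subseteq> \<Union>\<F>"
      unfolding compactin_def by meson
    define U where "U = topspace X - \<Union>\<F>"
    have "y \<notin> f ` U"
      using \<F>(3) by (auto simp: U_def)
    hence "y \<notin> Y closure_of (f ` U)"
      using off[of \<F>] \<F> y by (auto simp: U_def)
    moreover have "openin (subtopology Y S) ((topspace Y - Y closure_of (f ` U)) \<inter> S)"
      by (auto simp: openin_subtopology intro!: exI[of _ "topspace Y - Y closure_of (f ` U)"])
    moreover have "(topspace Y - Y closure_of (f ` U)) \<inter> S \<subseteq> S - f ` C'"
    proof -
      have "C' \<subseteq> U"
        using C \<F> by (auto simp: U_def)
      moreover have "f ` U \<subseteq> Y closure_of (f ` U)"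
        using fXY by (intro closure_of_subset) (auto simp: U_def)
      ultimately show ?thesis
        by blast
    qed
    ultimately show "\<exists>T. openin (subtopology Y S) T \<and> y \<in> T \<and> T \<subseteq> S - f ` C'"
      using y S by blast
  qed
  moreover have "f ` C' \<subseteq> S" "topspace (subtopology Y S) = S"
    using C S by auto
  ultimately show "closedin (subtopology Y S) (f ` C')"
    by (simp add: closedin_def)
qed

text \<open>The Cantor set enters the result only through a countable base of clopen sets, so the
  decomposition is carried out for any such \<open>X\<close>.\<close>

theorem clopen_LC_decomposition:
  assumes onto: "f ` topspace X = topspace Y"
    and LC: "clopen_LC X Y f"
    and cnt: "countable \<B>"
    and clopen: "\<And>B. B \<in> \<B> \<Longrightarrow> openin X B \<and> closedin X B"
    and base: "\<And>W x. openin X W \<Longrightarrow> x \<in> W \<Longrightarrow> \<exists>B\<in>\<B>. x \<in> B \<and> B \<subseteq> W"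
    and fibre: "\<And>y. y \<in> topspace Y \<Longrightarrow> compactin X {x \<in> topspace X. f x = y}"
  shows "\<exists>Yn :: nat \<Rightarrow> 'b set. (\<forall>n. Yn n \<subseteq> topspace Y) \<and> topspace Y = (\<Union>n. Yn n)
    \<and> (\<forall>n\<ge>1. open_map (subtopology X {x \<in> topspace X. f x \<in> Yn n}) (subtopology Y (Yn n)) f)
    \<and> closed_map (subtopology X {x \<in> topspace X. f x \<in> Yn 0}) (subtopology Y (Yn 0)) f"
proof -
  define \<FF> where "\<FF> = {\<F>. finite \<F> \<and> \<F> \<subseteq> \<B>}"
  define U where "U \<F> = topspace X - \<Union>\<F>" for \<F>
  define Z where "Z \<F> = Y closure_of (f ` U \<F>) - f ` U \<F>" for \<F>
  \<comment> \<open>Index 0 is kept for the closed piece, so the frontiers are enumerated from index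
    1. They may overlap: the pieces form a cover, not necessarily a partition.\<close>
  define Yn where "Yn n = (case n of 0 \<Rightarrow> topspace Y - (\<Union>\<F>\<in>\<FF>. Z \<F>)
    | Suc m \<Rightarrow> Z (from_nat_into \<FF> m))" for n
  have "countable \<FF>"
    unfolding \<FF>_def using countable_Collect_finite_subset[OF cnt] by simp
  \<comment> \<open>The empty family belongs to \<open>\<FF>\<close>; without a member,
    \<open>from_nat_into\<close> would return values outside \<open>\<FF>\<close>.\<close>
  moreover have "\<FF> \<noteq> {}"
    by (auto simp: \<FF>_def)
  ultimately have range: "range (from_nat_into \<FF>) = \<FF>"
    by (rule range_from_nat_into[rotated])
  have ZY: "Z \<F> \<subseteq> topspace Y" for \<F>
    using closure_of_subset_topspace[of Y] unfolding Z_def by blast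
  have clopen_U: "openin X (U \<F>) \<and> closedin X (U \<F>)" if "\<F> \<in> \<FF>" for \<F>
  proof -
    have "openin X (\<Union>\<F>)" "closedin X (\<Union>\<F>)"
      using that clopen by (auto simp: \<FF>_def intro!: closedin_Union)
    thus ?thesis
      by (auto simp: U_def)
  qed
  have "Yn n \<subseteq> topspace Y" for n
    using ZY by (auto simp: Yn_def split: nat.splits)
  moreover have "topspace Y \<subseteq> (\<Union>n. Yn n)"
  proof
    fix y assume y: "y \<in> topspace Y"
    show "y \<in> (\<Union>n. Yn n)"
    proof (cases "\<exists>\<F>\<in>\<FF>. y \<in> Z \<F>")
      case True
      then obtain m where "y \<in> Z (from_nat_into \<FF> m)"
        using range by (metis imageE)
      hence "y \<in> Yn (Suc m)"
        by (simp add: Yn_def)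
      thus ?thesis
        by blast
    next
      case False
      hence "y \<in> Yn 0"
        using y by (simp add: Yn_def)
      thus ?thesis
        by blast
    qed
  qed
  moreover have "open_map (subtopology X {x \<in> topspace X. f x \<in> Yn n}) (subtopology Y (Yn n)) f"
    if "1 \<le> n" for n
  proof -
    obtain m where n: "n = Suc m"
      using \<open>1 \<le> n\<close> by (cases n) auto
    have "from_nat_into \<FF> m \<in> \<FF>"
      using range by blast
    from clopen_U[OF this] show ?thesis
      by (intro open_map_over_frontier[OF _ LC clopen base, where U = "U (from_nat_into \<FF> m)"])
        (auto simp: n Yn_def Z_def onto)
  qed
  moreover have "closed_map (subtopology X {x \<in> topspace X. f x \<in> Yn 0}) (subtopology Y (Yn 0)) f"
    by (rule closed_map_off_frontiers[OF _ _ base fibre])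
      (use clopen in \<open>auto simp: Yn_def Z_def U_def \<FF>_def onto\<close>)
  ultimately show ?thesis
    by (intro exI[of _ Yn]) blast
qed

section \<open>Clopen bases in subsets of the Cantor set\<close>

text \<open>These are the midpoints of all triadic intervals
  \<open>[k / 3 ^ n, (k + 1) / 3 ^ n]\<close>, whose open middle thirds miss the Cantor set. Letting
  \<open>k\<close> run over all integers makes them dense in the whole line.\<close>

definition gap_midpoints :: "real set" where
  "gap_midpoints = range (\<lambda>(k::int, n::nat). (of_int k + 1/2) / 3 ^ n)"

lemma countable_gap_midpoints: "countable gap_midpoints"
  by (simp add: gap_midpoints_def)

text \<open>Multiplying a point of the Cantor set by \<open>3 ^ n\<close> gives an integer plus a number in
  \<open>[0, 1/3] \<union> [2/3, 1]\<close>.\<close>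
lemma gap_midpoints_disjoint_cantor_set: "gap_midpoints \<inter> cantor_set = {}"
proof -
  have False if x: "x \<in> cantor_set" "x = (of_int k + 1/2) / 3 ^ n" for x and k :: int and n :: nat
  proof -
    obtain d :: "nat \<Rightarrow> nat" where d: "\<And>n. d n \<in> {0, 2}"
      and xd: "x = (\<Sum>n. real (d n) / 3 ^ Suc n)"
      using x by (auto simp: cantor_set_def)
    define a where "a i = real (d i) / 3 ^ Suc i" for i
    have geo: "(\<lambda>i. 2 / 3 ^ Suc i :: real) sums 1"
      using sums_mult[OF geometric_sums[of "1/3::real"], of "2/3"] by (simp add: power_divide)
    have a_bounds: "0 \<le> a i" "a i \<le> 2 / 3 ^ Suc i" for i
      using d[of i] by (auto simp: a_def)
    have summ: "summable a"
      using a_bounds by (intro summable_comparison_test'[OF sums_summable[OF geo]]) auto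
    \<comment> \<open>The ternary digits after position \<open>n\<close>, rescaled to a number in
      \<open>[0, 1]\<close>; the value 1 occurs when all of them are 2.\<close>
    define t where "t = (\<Sum>i. 3 ^ Suc n * a (i + Suc n))"
    have tail_bounds: "0 \<le> 3 ^ Suc n * a (i + Suc n)" "3 ^ Suc n * a (i + Suc n) \<le> 2 / 3 ^ Suc i" for i
      using a_bounds[of "i + Suc n"] by (auto simp: field_simps power_add)
    have summ': "summable (\<lambda>i. a (i + Suc n))"
      using summ by (simp only: summable_iff_shift)
    hence summ'': "summable (\<lambda>i. 3 ^ Suc n * a (i + Suc n))"
      by (rule summable_mult)
    have "t \<le> (\<Sum>i. 2 / 3 ^ Suc i)"
      unfolding t_def using tail_bounds summ'' sums_summable[OF geo] by (intro suminf_le)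
    hence t1: "t \<le> 1"
      using geo by (simp add: sums_iff)
    have t0: "0 \<le> t"
      unfolding t_def using tail_bounds summ'' by (intro suminf_nonneg)
    have t: "t = 3 ^ Suc n * (\<Sum>i. a (i + Suc n))"
      unfolding t_def using summ' by (rule suminf_mult)
    \<comment> \<open>The integer whose ternary digits are
      \<open>d 0, ..., d (n - 1)\<close>.\<close>
    define N where "N = (\<Sum>i<n. d i * 3 ^ (n - Suc i))"
    have N: "3 ^ n * (\<Sum>i<n. a i) = real N"
      unfolding N_def sum_distrib_left of_nat_sum
    proof (intro sum.cong refl)
      fix i assume "i \<in> {..<n}"
      hence "(3::real) ^ n = 3 ^ Suc i * 3 ^ (n - Suc i)"
        by (subst power_add[symmetric]) auto
      thus "3 ^ n * a i = real (d i * 3 ^ (n - Suc i))"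
        by (simp add: a_def)
    qed
    have "x = (\<Sum>i. a (i + Suc n)) + (\<Sum>i<Suc n. a i)"
      unfolding xd a_def[symmetric] using summ by (rule suminf_split_initial_segment)
    hence "3 ^ n * x = real N + real (d n) / 3 + t / 3"
      using N t by (simp add: algebra_simps a_def)
    moreover have "3 ^ n * x = of_int k + 1/2"
      using x by simp
    ultimately have eq: "3 * of_int (2 * k + 1) = 3 * (2 * real N) + 2 * real (d n) + 2 * t"
      by (simp add: field_simps)
    \<comment> \<open>Since \<open>j\<close> equals \<open>2 * t\<close>, it lies between 0 and 2.
      But modulo 6 it is 3 when \<open>d n = 0\<close> and 5 when \<open>d n = 2\<close>.\<close>
    define j where "j = 6 * k + 3 - 6 * int N - 2 * int (d n)"
    have "real_of_int j = 2 * t"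
      using eq by (simp add: j_def)
    hence "0 \<le> j" "j \<le> 2"
      using t0 t1 by linarith+
    moreover have "int (d n) = 0 \<or> int (d n) = 2"
      using d[of n] by auto
    ultimately show False
      unfolding j_def by presburger
  qed
  thus ?thesis
    by (auto simp: gap_midpoints_def)
qed

lemma gap_midpoints_dense:
  fixes a b :: real
  assumes "a < b"
  obtains q where "q \<in> gap_midpoints" "a < q" "q < b"
proof -
  obtain n where n: "1 / (b - a) < 3 ^ n"
    using real_arch_pow[of 3 "1 / (b - a)"] by auto
  hence "1 < 3 ^ n * b - 3 ^ n * a"
    using assms by (simp add: field_simps)
  \<comment> \<open>This makes \<open>k + 1/2\<close> the least half-integer above
    \<open>3 ^ n * a\<close>. It exceeds that number by at most 1, hence stays below
    \<open>3 ^ n * b\<close>.\<close>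
  define k where "k = \<lfloor>3 ^ n * a + 1/2\<rfloor>"
  have "of_int k \<le> 3 ^ n * a + 1/2" "3 ^ n * a + 1/2 < of_int k + 1"
    unfolding k_def by linarith+
  show thesis
  proof
    show "(of_int k + 1/2) / 3 ^ n \<in> gap_midpoints"
      unfolding gap_midpoints_def by (rule image_eqI[of _ _ "(k, n)"]) auto
    show "a < (of_int k + 1/2) / 3 ^ n" "(of_int k + 1/2) / 3 ^ n < b"
      using \<open>of_int k \<le> _\<close> \<open>_ < of_int k + 1\<close> \<open>1 < _\<close> by (simp_all add: field_simps)
  qed
qed

text \<open>An interval with endpoints in \<open>gap_midpoints\<close> has the same trace on
  \<open>X\<close> whether taken open or closed, so the trace is clopen. Density of the endpoints
  makes these traces a base.\<close>

lemma cantor_subset_clopen_base: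
  assumes "X \<subseteq> cantor_set"
  obtains \<B> where "countable \<B>"
    "\<And>B. B \<in> \<B> \<Longrightarrow> openin (top_of_set X) B \<and> closedin (top_of_set X) B"
    "\<And>W x. openin (top_of_set X) W \<Longrightarrow> x \<in> W \<Longrightarrow> \<exists>B\<in>\<B>. x \<in> B \<and> B \<subseteq> W"
proof
  let ?\<B> = "(\<lambda>(a, b). X \<inter> {a<..<b}) ` (gap_midpoints \<times> gap_midpoints)"
  show "countable ?\<B>"
    by (intro countable_image countable_SIGMA countable_gap_midpoints)
  show "openin (top_of_set X) B \<and> closedin (top_of_set X) B" if B: "B \<in> ?\<B>" for B
  proof -
    obtain a b where ab: "a \<in> gap_midpoints" "b \<in> gap_midpoints" "B = X \<inter> {a<..<b}"
      using B by blast
    have "a \<notin> X" "b \<notin> X"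
      using ab assms gap_midpoints_disjoint_cantor_set by auto
    hence "B = X \<inter> {a..b}"
      unfolding ab by (auto simp: less_le)
    thus ?thesis
      using ab by (metis closedin_closed_Int closed_atLeastAtMost openin_open_Int open_greaterThanLessThan)
  qed
  show "\<exists>B\<in>?\<B>. x \<in> B \<and> B \<subseteq> W" if W: "openin (top_of_set X) W" "x \<in> W" for W x
  proof -
    obtain e where e: "e > 0" "ball x e \<inter> X \<subseteq> W" "x \<in> X"
      using W unfolding openin_contains_ball by blast
    obtain a where a: "a \<in> gap_midpoints" "x - e < a" "a < x"
      using gap_midpoints_dense[of "x - e" x] e by auto
    obtain b where b: "b \<in> gap_midpoints" "x < b" "b < x + e"
      using gap_midpoints_dense[of x "x + e"] e by auto
    have "X \<inter> {a<..<b} \<subseteq> ball x e \<inter> X"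
      using a b by (auto simp: dist_real_def)
    with e a b show ?thesis
      by (intro bexI[of _ "X \<inter> {a<..<b}"]) auto
  qed
qed

theorem theorem1:
  fixes X :: "real set" and Y :: "'b topology" and f :: "real \<Rightarrow> 'b"
  assumes "X \<subseteq> cantor_set"
    and "metrizable_space Y" and "separable_space Y"
    and "f ` X = topspace Y"
    and "clopen_LC (subtopology euclideanreal X) Y f"
    and "\<And>y. y \<in> topspace Y \<Longrightarrow> compactin (subtopology euclideanreal X) {x \<in> X. f x = y}"
  shows "\<exists>Yn :: nat \<Rightarrow> 'b set. (\<forall>n. Yn n \<subseteq> topspace Y) \<and> topspace Y = (\<Union>n. Yn n)
          \<and> (\<forall>n\<ge>1. open_map (subtopology euclideanreal {x \<in> X. f x \<in> Yn n}) (subtopology Y (Yn n)) f)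
          \<and> closed_map (subtopology euclideanreal {x \<in> X. f x \<in> Yn 0}) (subtopology Y (Yn 0)) f"
proof -
  obtain \<B> where \<B>: "countable \<B>"
    "\<And>B. B \<in> \<B> \<Longrightarrow> openin (top_of_set X) B \<and> closedin (top_of_set X) B"
    "\<And>W x. openin (top_of_set X) W \<Longrightarrow> x \<in> W \<Longrightarrow> \<exists>B\<in>\<B>. x \<in> B \<and> B \<subseteq> W"
    using cantor_subset_clopen_base[OF assms(1)] by metis
  \<comment> \<open>The general result restricts \<open>f\<close> to subspaces of \<open>X\<close>;
    here they are identified with subspaces of the real line.\<close>
  have sub: "subtopology (top_of_set X) {x \<in> X. f x \<in> S} = top_of_set {x \<in> X. f x \<in> S}" for S
    by (simp add: subtopology_subtopology Int_absorb1 Collect_restrict)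
  have "f ` topspace (top_of_set X) = topspace Y"
    using assms(4) by simp
  from clopen_LC_decomposition[OF this assms(5) \<B>] show ?thesis
    using assms(6) by (simp add: sub)
qed

end
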